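(* Let $(a_n)_{n\ge 0}$ be a sequence of complex numbers with $|a_n|=1$ for all $n\ge 0$, and let $f(z)=\sum_{n=0}^\infty a_n z^n/n!$. Then the indicator $h_f$ of $f$ is non-negative, i.e. $h_f(\theta)\ge 0$ for all $\theta\in[-\pi,\pi]$, unless there are a constant $c$ and a complex number $a$ with $|a|=1$ such that $a_n=c\,a^n$ for all $n\ge 0$, in which case $f(z)=c\,e^{az}$.
   Context: For an entire function $f$ of exponential type (such as the function $f$ in the claim), the (Phragmén–Lindelöf) indicator is $$h_f(\theta)=\limsup_{r\to\infty} r^{-1}\log|f(re^{i\theta})|,\qquad |\theta|\le\pi.$$ *)

theory Defs
  imports "HOL-Analysis.Analysis"
begin

(* The library has ln 0 = 0; the indicator needs log 0 = -infinity at the zeros of f. *)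
definition log_ext :: "real \<Rightarrow> ereal" where
  "log_ext x = (if x = 0 then - \<infinity> else ereal (ln x))"

definition indicator_PL :: "(complex \<Rightarrow> complex) \<Rightarrow> real \<Rightarrow> ereal" where
  "indicator_PL f \<theta> =
     Limsup at_top (\<lambda>r::real. ereal (inverse r) * log_ext (cmod (f (of_real r * cis \<theta>))))"

end

(* If the indicator is negative in some direction, rotate so that f decays exponentially on the
   negative axis.  The Laplace transform of f then continues the Borel transform
   F(w) = sum a_n / w^(n+1) from |w| > 1 across a half-plane containing 0, and a_n becomes the
   moment of F(w) w^n over a circle lying in Re w > 0.  Replacing w^n by w^s interpolates a_n by an
   entire function Phi of exponential type.  Since |a_n| = 1, the products w v*, with w and v on the
   circle, carry a distribution all of whose moments equal 1; as these products avoid the negative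
   axis, analytic continuation turns this into Phi(s) Phi*(s) = 1 for all s.  So Phi has no zeros,
   hence is the exponential of a linear function. *)
theory Submission
  imports Defs "HOL-Complex_Analysis.Complex_Analysis"
begin

text \<open>An entire function of exponential type is not determined by its values at the integers
  (\<open>sin (pi * s)\<close> vanishes at all of them), so the identity for Phi cannot simply be
  extended from integer \<open>s\<close>. The way around is to shift the product variable
  \<open>u\<close> by \<open>z\<close>. For large positive \<open>z\<close> the power
  \<open>(z + u) powr s\<close> has a binomial expansion in powers of \<open>u\<close>, so its
  integral depends on the integer moments alone. The result is then carried back to
  \<open>z = 0\<close> along the positive axis, which requires \<open>u\<close> to stay off the
  closed negative axis. Two factors with arguments below pi/2 in modulus guarantee this, and this is
  why the circle has to lie in the open right half-plane. The exponential decay is spent exactly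
  there: it leaves the singularities of the Borel transform only the part of the closed unit disc
  with real part at least \<open>\<delta>\<close> > 0.\<close>

section \<open>Exponential generating functions of bounded sequences\<close>

definition egf :: "(nat \<Rightarrow> complex) \<Rightarrow> complex \<Rightarrow> complex" where
  "egf b z = (\<Sum>n. b n * z ^ n / fact n)"

lemma norm_egf_term_le:
  assumes "\<And>n. cmod (b n) \<le> B"
  shows "norm (b n * z ^ n / fact n) \<le> B * (norm z ^ n /\<^sub>R fact n)"
proof -
  have "norm (b n * z ^ n / fact n) = norm (b n) * (norm z ^ n / fact n)"
    by (simp add: norm_mult norm_divide norm_power)
  also have "\<dots> \<le> B * (norm z ^ n / fact n)"
    using assms by (intro mult_right_mono) auto
  finally show ?thesis by (simp add: divide_inverse mult.commute)
qed

lemma summable_egf: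
  assumes "\<And>n. cmod (b n) \<le> B"
  shows "summable (\<lambda>n. norm (b n * z ^ n / fact n))"
  by (rule summable_comparison_test'[OF summable_mult[OF summable_exp_generic[of "norm z"], of B]])
    (use norm_egf_term_le[of b B _ z] assms in simp)

lemma norm_egf_le:
  assumes "\<And>n. cmod (b n) \<le> B"
  shows "norm (egf b z) \<le> B * exp (norm z)"
proof -
  have "norm (egf b z) \<le> (\<Sum>n. B * (norm z ^ n /\<^sub>R fact n))"
    unfolding egf_def
    using norm_egf_term_le[of b B _ z] assms summable_exp_generic[of "norm z"]
    by (intro norm_suminf_le summable_mult) auto
  also have "\<dots> = B * exp (norm z)"
    by (simp only: exp_def suminf_mult[OF summable_exp_generic])
  finally show ?thesis .
qed

lemma egf_has_field_derivative:
  assumes "\<And>n. cmod (b n) \<le> B"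
  shows "(egf b has_field_derivative egf (\<lambda>n. b (Suc n)) z) (at z)"
proof -
  define c where "c n = b n / fact n" for n
  have "summable (\<lambda>n. c n * (of_real (norm z + 1)) ^ n)"
    using summable_norm_cancel[OF summable_egf[of b B "of_real (norm z + 1)"]] assms
    by (simp add: c_def)
  then have "((\<lambda>z. \<Sum>n. c n * z ^ n) has_field_derivative (\<Sum>n. diffs c n * z ^ n)) (at z)"
    by (rule termdiffs_strong) (simp add: abs_if)
  moreover have "diffs c n = b (Suc n) / fact n" for n
    by (simp add: diffs_def c_def field_simps del: of_nat_Suc)
  ultimately show ?thesis by (simp add: egf_def[abs_def] c_def)
qed

section \<open>The Borel transform outside the unit disc, and its Laplace integral\<close>

text \<open>This is the termwise Laplace transform of \<open>egf b\<close>: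
  \<open>t^n / fact n\<close> goes to \<open>1 / w ^ Suc n\<close>.\<close>

definition borel_transform :: "(nat \<Rightarrow> complex) \<Rightarrow> complex \<Rightarrow> complex" where
  "borel_transform b w = (\<Sum>n. b n / w ^ Suc n)"

lemma borel_transform_term_le:
  assumes "\<And>n. cmod (b n) \<le> B"
  shows "cmod (b n / w ^ Suc n) \<le> B * (1 / cmod w) ^ Suc n"
proof -
  have "cmod (b n / w ^ Suc n) = cmod (b n) * (1 / cmod w) ^ Suc n"
    by (simp only: norm_divide norm_power power_divide) simp
  also have "\<dots> \<le> B * (1 / cmod w) ^ Suc n"
    using assms by (intro mult_right_mono) auto
  finally show ?thesis .
qed

lemma geometric_tail_sums:
  fixes x :: real
  assumes "1 < x"
  shows "(\<lambda>n. (1 / x) ^ Suc n) sums (1 / (x - 1))"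
proof -
  have "(\<lambda>n. 1 / x * (1 / x) ^ n) sums (1 / x * (1 / (1 - 1 / x)))"
    using assms by (intro sums_mult geometric_sums) simp
  moreover have "1 / x * (1 / (1 - 1 / x)) = 1 / (x - 1)"
    using assms by (simp add: field_simps)
  ultimately show ?thesis by simp
qed

lemma summable_borel_transform:
  assumes "\<And>n. cmod (b n) \<le> B" "1 < cmod w"
  shows "summable (\<lambda>n. b n / w ^ Suc n)"
proof (rule summable_comparison_test'[where N = 0])
  show "summable (\<lambda>n. B * (1 / cmod w) ^ Suc n)"
    by (intro summable_mult sums_summable[OF geometric_tail_sums[OF assms(2)]])
  show "cmod (b n / w ^ Suc n) \<le> B * (1 / cmod w) ^ Suc n" for n
    by (rule borel_transform_term_le) (rule assms)
qed

lemma norm_borel_transform_le: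
  assumes "\<And>n. cmod (b n) \<le> B" "1 < cmod w"
  shows "cmod (borel_transform b w) \<le> B / (cmod w - 1)"
proof -
  have s: "(\<lambda>n. B * (1 / cmod w) ^ Suc n) sums (B * (1 / (cmod w - 1)))"
    by (intro sums_mult geometric_tail_sums assms)
  have "cmod (borel_transform b w) \<le> (\<Sum>n. B * (1 / cmod w) ^ Suc n)"
    unfolding borel_transform_def
    by (intro norm_suminf_le sums_summable[OF s] borel_transform_term_le assms)
  then show ?thesis using sums_unique[OF s] by simp
qed

text \<open>Split off the first term of the series. Read as a recursion over all shifts of
  \<open>b\<close>, this becomes the differential equation behind
  \<open>laplace_egf\<close>.\<close>

lemma borel_transform_shift:
  assumes "\<And>n. cmod (b n) \<le> B" "1 < cmod w"
  shows "borel_transform (\<lambda>n. b (Suc n)) w = w * borel_transform b w - b 0"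
proof -
  have "w \<noteq> 0" using assms(2) by auto
  have "borel_transform b w = b 0 / w + (\<Sum>n. b (Suc n) / w ^ Suc (Suc n))"
    unfolding borel_transform_def using suminf_split_head[OF summable_borel_transform[of b B w]] assms
    by simp
  also have "(\<Sum>n. b (Suc n) / w ^ Suc (Suc n)) = borel_transform (\<lambda>n. b (Suc n)) w / w"
    unfolding borel_transform_def
    by (subst suminf_divide[symmetric])
      (use summable_borel_transform[of "\<lambda>n. b (Suc n)" B w] assms in \<open>auto simp: field_simps\<close>)
  finally show ?thesis using \<open>w \<noteq> 0\<close> by (simp add: field_simps)
qed

lemma borel_transform_holomorphic:
  assumes "\<And>n. cmod (b n) \<le> B"
  shows "borel_transform b holomorphic_on {w. 1 < cmod w}"
proof (rule holomorphic_uniform_sequence)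
  show op: "open {w :: complex. 1 < cmod w}"
    by (intro open_Collect_less continuous_intros)
  show "(\<lambda>w. \<Sum>k<n. b k / w ^ Suc k) holomorphic_on {w. 1 < cmod w}" for n
    by (intro holomorphic_intros) auto
  fix w :: complex assume w: "w \<in> {w. 1 < cmod w}"
  \<comment> \<open>\<open>\<rho>\<close> is midway between 1 and \<open>cmod w\<close>, and the
    disc of radius \<open>d\<close> about \<open>w\<close> stays outside radius
    \<open>\<rho>\<close>, so one geometric series dominates on it.\<close>
  define \<rho> where "\<rho> = (1 + cmod w) / 2"
  define d where "d = (cmod w - 1) / 2"
  have \<rho>: "1 < \<rho>" "0 < d" using w by (auto simp: \<rho>_def d_def)
  have far: "\<rho> \<le> cmod v" if "v \<in> cball w d" for v
    using that norm_triangle_sub[of w v] by (simp add: dist_norm \<rho>_def d_def field_simps)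
  have "uniform_limit (cball w d) (\<lambda>n v. \<Sum>k<n. b k / v ^ Suc k)
      (\<lambda>v. \<Sum>k. b k / v ^ Suc k) sequentially"
  proof (rule Weierstrass_m_test)
    show "summable (\<lambda>n. B * (1 / \<rho>) ^ Suc n)"
      by (intro summable_mult sums_summable[OF geometric_tail_sums[OF \<rho>(1)]])
    fix n v assume "v \<in> cball w d"
    then have "\<rho> \<le> cmod v" by (rule far)
    have "0 \<le> B" using order_trans[OF norm_ge_zero assms] .
    then have "B * (1 / cmod v) ^ Suc n \<le> B * (1 / \<rho>) ^ Suc n"
      using \<open>\<rho> \<le> cmod v\<close> \<rho> by (intro mult_left_mono power_mono divide_left_mono mult_pos_pos) auto
    then show "cmod (b n / v ^ Suc n) \<le> B * (1 / \<rho>) ^ Suc n"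
      using borel_transform_term_le[of b B n v] assms by (meson order_trans)
  qed
  then show "\<exists>d>0. cball w d \<subseteq> {w. 1 < cmod w} \<and>
      uniform_limit (cball w d) (\<lambda>n w. \<Sum>k<n. b k / w ^ Suc k) (borel_transform b) sequentially"
    using \<rho> far by (intro exI[of _ d]) (force simp: borel_transform_def[abs_def])
qed

text \<open>The exponential generating function \<open>g\<close> of the Borel transforms of the shifted sequences
  satisfies \<open>g' = w g - egf b\<close>, so \<open>exp (w t) egf b (- t)\<close> has the antiderivative
  \<open>exp (w t) g (- t)\<close>.\<close>

lemma laplace_egf:
  fixes w :: complex and T :: real
  assumes b: "\<And>n. cmod (b n) \<le> B" and w: "1 < cmod w" and T: "0 \<le> T"
  shows "integral {0..T} (\<lambda>t. exp (w * t) * egf b (- of_real t)) =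
    exp (w * T) * egf (\<lambda>n. borel_transform (\<lambda>k. b (n + k)) w) (- of_real T) - borel_transform b w"
proof -
  define d where "d n = borel_transform (\<lambda>k. b (n + k)) w" for n
  \<comment> \<open>All shifts of \<open>b\<close> share the bound \<open>B\<close>, so
    \<open>d\<close> is itself bounded and \<open>egf d\<close> is entire.\<close>
  have d: "cmod (d n) \<le> B / (cmod w - 1)" for n
    unfolding d_def using b w by (intro norm_borel_transform_le)
  have d_Suc: "d (Suc n) = w * d n - b n" for n
    using borel_transform_shift[of "\<lambda>k. b (n + k)" B w] b w by (simp add: d_def)
  have "egf (\<lambda>n. d (Suc n)) z = w * egf d z - egf b z" for z
  proof -
    have sd: "summable (\<lambda>n. w * (d n * z ^ n / fact n))"
      using summable_norm_cancel[OF summable_egf[of d, OF d]] by (rule summable_mult)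
    have "egf (\<lambda>n. d (Suc n)) z = (\<Sum>n. w * (d n * z ^ n / fact n) - b n * z ^ n / fact n)"
      unfolding egf_def d_Suc by (simp add: field_simps)
    also have "\<dots> = w * egf d z - egf b z"
      unfolding egf_def suminf_mult[OF summable_norm_cancel[OF summable_egf[of d, OF d]], symmetric]
      by (rule suminf_diff[OF sd summable_norm_cancel[OF summable_egf[of b, OF b]], symmetric])
    finally show ?thesis .
  qed
  then have egf_b: "egf b z = w * egf d z - egf (\<lambda>n. d (Suc n)) z" for z by simp
  \<comment> \<open>The inner \<open>- t\<close> reverses the sign of the derivative of
    \<open>egf d\<close>, which leaves exactly the combination in \<open>egf_b\<close>.\<close>
  have deriv: "((\<lambda>t. exp (w * t) * egf d (- t)) has_field_derivative exp (w * t) * egf b (- t)) (at t within S)"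
    for t S
    by (auto intro!: derivative_eq_intros DERIV_chain2[OF egf_has_field_derivative[of d, OF d]]
        simp: egf_b algebra_simps)
  have "((\<lambda>t. exp (w * t) * egf b (- of_real t)) has_integral
      exp (w * T) * egf d (- of_real T) - exp (w * of_real 0) * egf d (- of_real 0)) {0..T}"
    using T by (intro fundamental_theorem_of_calculus)
      (auto intro!: has_vector_derivative_real_field deriv)
  moreover have "egf d 0 = d 0"
    using powser_zero[of "\<lambda>n. d n / fact n"] by (simp add: egf_def)
  moreover have "d 0 = borel_transform b w" by (simp add: d_def)
  ultimately show ?thesis by (simp add: integral_unique d_def[abs_def, symmetric])
qed


section \<open>Analytic continuation of the Borel transform\<close>

text \<open>\<open>L\<close> is the Laplace integral over the whole half-line, which the decay makes
  convergent for \<open>Re w < \<delta>\<close>. For \<open>Re w < - 1\<close> the finite formula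
  \<open>laplace_egf\<close> passes to the limit, since its boundary term vanishes there.\<close>

lemma laplace_continuation:
  assumes b: "\<And>n. cmod (b n) \<le> B"
    and decay: "\<And>t. 0 \<le> t \<Longrightarrow> cmod (egf b (- of_real t)) \<le> C * exp (- \<delta> * t)"
  obtains L where "L holomorphic_on {w. Re w < \<delta>}"
    and "\<And>w. Re w < - 1 \<Longrightarrow> L w = - borel_transform b w"
proof
  have C: "0 \<le> C" using order_trans[OF norm_ge_zero decay[of 0]] by simp
  have cont_egf: "continuous_on A (egf b)" for A
    using egf_has_field_derivative[OF b] by (meson DERIV_isCont continuous_at_imp_continuous_on)
  have cont: "continuous_on A (\<lambda>x. egf b (- of_real (g x)))" if "continuous_on A g"
    for A and g :: "'a :: topological_space \<Rightarrow> real"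
    by (rule continuous_on_compose2[OF cont_egf]) (use that in \<open>auto intro!: continuous_intros\<close>)
  define h where "h w t = exp (w * of_real t) * egf b (- of_real t)" for w :: complex and t :: real
  have cont_h: "continuous_on A (h w)" for A w
    unfolding h_def by (intro continuous_intros cont)
  \<comment> \<open>Cutting the half-line into unit intervals turns the improper integral into a
    series of entire functions, so holomorphy follows from locally uniform convergence.\<close>
  define J where "J n w = integral {real n..real n + 1} (h w)" for n w
  define L where "L w = (\<Sum>n. J n w)" for w
  have sum_J: "(\<Sum>i<n. J i w) = integral {0..real n} (h w)" for n w
  proof (induction n)
    case (Suc n)
    have "integral {0..real n} (h w) + integral {real n..real n + 1} (h w) = integral {0..real n + 1} (h w)"
      using cont_h by (intro Henstock_Kurzweil_Integration.integral_combine integrable_continuous_real) auto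
    then show ?case using Suc by (simp add: J_def add.commute)
  qed simp
  show "L w = - borel_transform b w" if w: "Re w < - 1" for w
  proof -
    have w1: "1 < cmod w" using w abs_Re_le_cmod[of w] by linarith
    define d where "d n = borel_transform (\<lambda>k. b (n + k)) w" for n
    have d: "cmod (d n) \<le> B / (cmod w - 1)" for n
      unfolding d_def using b w1 by (intro norm_borel_transform_le)
    \<comment> \<open>The boundary term: \<open>egf d\<close> grows at most like
      \<open>exp n\<close>, and \<open>exp (Re w * n)\<close> outweighs this because
      \<open>Re w + 1 < 0\<close>.\<close>
    have "(\<lambda>n. exp (w * n) * egf d (- of_real (real n))) \<longlonglongrightarrow> 0"
    proof (rule Lim_null_comparison)
      show "(\<lambda>n. B / (cmod w - 1) * exp (Re w + 1) ^ n) \<longlonglongrightarrow> 0"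
        using w by (intro tendsto_mult_right_zero LIMSEQ_realpow_zero) auto
      show "\<forall>\<^sub>F n in sequentially. cmod (exp (w * n) * egf d (- of_real (real n)))
          \<le> B / (cmod w - 1) * exp (Re w + 1) ^ n"
      proof (intro always_eventually allI)
        fix n
        have "cmod (exp (w * n) * egf d (- of_real (real n)))
            \<le> exp (Re w * n) * (B / (cmod w - 1) * exp n)"
          unfolding norm_mult using norm_egf_le[of d, OF d, of "- of_real (real n)"]
          by (intro mult_mono) auto
        also have "\<dots> = B / (cmod w - 1) * exp (Re w + 1) ^ n"
          by (simp add: exp_of_nat_mult[symmetric] exp_add[symmetric] algebra_simps)
        finally show "cmod (exp (w * n) * egf d (- of_real (real n)))
            \<le> B / (cmod w - 1) * exp (Re w + 1) ^ n" .
      qed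
    qed
    then have "(\<lambda>n. exp (w * n) * egf d (- of_real (real n)) - borel_transform b w)
        \<longlonglongrightarrow> 0 - borel_transform b w"
      by (intro tendsto_diff tendsto_const)
    moreover have "(\<Sum>i<n. J i w) = exp (w * n) * egf d (- of_real (real n)) - borel_transform b w" for n
      using laplace_egf[of b B w "real n"] b w1 by (simp add: sum_J h_def[abs_def] d_def[abs_def])
    ultimately have "(\<lambda>n. J n w) sums (- borel_transform b w)" by (simp add: sums_def)
    then show ?thesis by (simp add: L_def sums_iff)
  qed
  show "L holomorphic_on {w. Re w < \<delta>}"
  proof (rule holomorphic_uniform_sequence)
    show "open {w. Re w < \<delta>}" by (rule open_halfspace_Re_lt)
    have "J k holomorphic_on UNIV" for k
      unfolding J_def cbox_interval[symmetric]
    proof (rule leibniz_rule_holomorphic[where fx = "\<lambda>w t. of_real t * h w t"])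
      show "((\<lambda>w. h w t) has_field_derivative of_real t * h w t) (at w within UNIV)" for w t
        unfolding h_def by (auto intro!: derivative_eq_intros)
      show "h w integrable_on cbox (real k) (real k + 1)" for w
        by (intro integrable_continuous cont_h)
      show "continuous_on (UNIV \<times> cbox (real k) (real k + 1)) (\<lambda>(w, t). of_real t * h w t)"
        unfolding h_def case_prod_unfold by (intro continuous_intros cont)
    qed simp
    then show "(\<lambda>w. \<Sum>k<n. J k w) holomorphic_on {w. Re w < \<delta>}" for n
      by (intro holomorphic_intros) (auto intro: holomorphic_on_subset)
    fix w assume w: "w \<in> {w. Re w < \<delta>}"
    \<comment> \<open>Half the distance to the boundary line: on the disc of radius
      \<open>\<epsilon>\<close> the integrand still decays at rate
      \<open>\<epsilon>\<close>.\<close>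
    define \<epsilon> where "\<epsilon> = (\<delta> - Re w) / 2"
    have \<epsilon>: "0 < \<epsilon>" using w by (simp add: \<epsilon>_def)
    have Re_v: "Re v \<le> \<delta> - \<epsilon>" if "v \<in> cball w \<epsilon>" for v
      using that abs_Re_le_cmod[of "v - w"] by (simp add: dist_norm norm_minus_commute \<epsilon>_def field_simps)
    have "uniform_limit (cball w \<epsilon>) (\<lambda>n v. \<Sum>k<n. J k v) (\<lambda>v. \<Sum>k. J k v) sequentially"
    proof (rule Weierstrass_m_test)
      show "summable (\<lambda>n. C * exp (- \<epsilon>) ^ n)"
        using \<epsilon> by (intro summable_mult summable_geometric) simp
      fix n v assume v: "v \<in> cball w \<epsilon>"
      have "cmod (h v t) \<le> C * exp (- \<epsilon>) ^ n" if t: "t \<in> {real n..real n + 1}" for t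
      proof -
        have t0: "0 \<le> t" using t by auto
        have "cmod (h v t) \<le> exp (Re v * t) * (C * exp (- \<delta> * t))"
          unfolding h_def norm_mult using decay[OF t0] by (intro mult_mono) auto
        also have "\<dots> = C * exp ((Re v - \<delta>) * t)" by (simp add: exp_add[symmetric] algebra_simps)
        also have "(Re v - \<delta>) * t \<le> (- \<epsilon>) * t" using Re_v[OF v] t0 by (intro mult_right_mono) auto
        also have "(- \<epsilon>) * t \<le> real n * (- \<epsilon>)" using \<epsilon> t by (simp add: mult.commute)
        finally show ?thesis using C by (simp add: exp_of_nat_mult[symmetric] mult_left_mono)
      qed
      then show "cmod (J n v) \<le> C * exp (- \<epsilon>) ^ n"
        using integral_bound[of "real n" "real n + 1" "h v"] cont_h by (simp add: J_def)
    qed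
    then show "\<exists>d>0. cball w d \<subseteq> {w. Re w < \<delta>} \<and>
        uniform_limit (cball w d) (\<lambda>n w. \<Sum>k<n. J k w) L sequentially"
      using Re_v \<epsilon> by (intro exI[of _ \<epsilon>]) (force simp: L_def[abs_def])
  qed
qed

text \<open>Each point of the region shares a convex piece, cut out by a tangent half-plane of the unit
  disc, with the half-plane \<open>Re w < - 1\<close>.\<close>

lemma connected_halfplane_minus_disc:
  assumes "- 1 \<le> \<delta>" "\<delta> \<le> 1"
  shows "connected {w. 1 < cmod w \<and> Re w < \<delta>}"
proof -
  \<comment> \<open>For a unit vector \<open>u\<close>, the first factor is the half-plane beyond
    the tangent to the unit circle at \<open>u\<close>.\<close>
  define H where "H u = {w :: complex. 1 < u \<bullet> w} \<inter> {w. Re w < \<delta>}" for u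
  define N where "N = {w :: complex. Re w < - 1}"
  define X where "X w = H (sgn w) \<union> N" for w
  let ?S = "{w. 1 < cmod w \<and> Re w < \<delta>}"
  have conn: "connected (X w)" if w: "w \<in> ?S" for w
    unfolding X_def
  proof (rule connected_Un)
    show "connected (H (sgn w))" unfolding H_def
      by (intro convex_connected convex_Int convex_halfspace_gt convex_halfspace_Re_lt)
    show "connected N" unfolding N_def by (intro convex_connected convex_halfspace_Re_lt)
    define v where "v = sgn w"
    have "w \<noteq> 0" using w by auto
    then have v: "cmod v = 1" by (simp add: v_def norm_sgn)
    \<comment> \<open>Only for \<open>v = 1\<close> would the tangent half-plane point away from
      \<open>N\<close>; this is excluded because
      \<open>Re w < \<delta> \<le> 1 < cmod w\<close>.\<close>
    have "Re v < 1"
    proof -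
      have "Re v = Re w / cmod w" by (simp add: v_def sgn_div_norm divide_inverse mult.commute)
      also have "\<dots> < 1" using w assms by (subst divide_less_eq_1_pos) auto
      finally show ?thesis .
    qed
    define k where "k = 2 / (1 - Re v)"
    have k: "k * (1 - Re v) = 2" unfolding k_def using \<open>Re v < 1\<close> by (intro nonzero_eq_divide_eq[THEN iffD1]) auto
    \<comment> \<open>The direction \<open>v - 1\<close> has inner product \<open>1 - Re v\<close>
      with \<open>v\<close> and real part \<open>-(1 - Re v)\<close>, so a single scaling by
      \<open>k\<close> reaches both half-planes.\<close>
    define x where "x = k *\<^sub>R (v - 1)"
    have "v \<bullet> x = k * (v \<bullet> v - v \<bullet> 1)"
      by (simp add: x_def inner_diff_right)
    also have "v \<bullet> v - v \<bullet> 1 = 1 - Re v"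
      using v by (simp add: norm_eq_1 inner_complex_def)
    finally have "v \<bullet> x = 2" using k by simp
    moreover have "Re x = - 2" using k by (simp add: x_def algebra_simps)
    ultimately have "x \<in> H (sgn w) \<inter> N"
      using assms(1) by (simp add: H_def N_def v_def[symmetric])
    then show "H (sgn w) \<inter> N \<noteq> {}" by blast
  qed
  have mem: "w \<in> X w" if "w \<in> ?S" for w
  proof -
    have "w \<noteq> 0" using that by auto
    then have "sgn w \<bullet> w = cmod w"
      by (simp add: sgn_div_norm dot_square_norm power2_eq_square)
    then show ?thesis using that by (simp add: X_def H_def)
  qed
  have sub: "X w \<subseteq> ?S" if "w \<in> ?S" for w
  proof
    fix z assume z: "z \<in> X w"
    have "sgn w \<bullet> z \<le> cmod z"
    proof -
      have "w \<noteq> 0" using that by auto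
      then show ?thesis using norm_cauchy_schwarz[of "sgn w" z] by (simp add: norm_sgn)
    qed
    moreover have "- Re z \<le> cmod z" using abs_Re_le_cmod[of z] by linarith
    ultimately show "z \<in> ?S" using z assms(1) by (auto simp: X_def H_def N_def)
  qed
  have "?S = \<Union> (X ` ?S)" using mem sub by blast
  moreover have "connected (\<Union> (X ` ?S))"
    \<comment> \<open>The point -2 lies in \<open>N\<close> and hence in every
      \<open>X w\<close>.\<close>
    by (rule connected_Union) (use conn in \<open>auto simp: X_def N_def intro!: exI[of _ "-2"]\<close>)
  ultimately show ?thesis by simp
qed

text \<open>The series and the Laplace integral are known to agree up to sign only for
  \<open>Re w < - 1\<close>. Connectedness of the whole overlap spreads the agreement, so the two
  pieces glue.\<close>

lemma borel_transform_continuation: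
  assumes b: "\<And>n. cmod (b n) \<le> B"
    and decay: "\<And>t. 0 \<le> t \<Longrightarrow> cmod (egf b (- of_real t)) \<le> C * exp (- \<delta> * t)"
    and \<delta>: "0 < \<delta>" "\<delta> \<le> 1"
  obtains F where "F holomorphic_on {w. 1 < cmod w} \<union> {w. Re w < \<delta>}"
    and "\<And>w. 1 < cmod w \<Longrightarrow> F w = borel_transform b w"
proof -
  obtain L where L: "L holomorphic_on {w. Re w < \<delta>}"
    "\<And>w. Re w < - 1 \<Longrightarrow> L w = - borel_transform b w"
    using laplace_continuation[OF b decay] by blast
  have eq: "borel_transform b w = - L w" if w: "1 < cmod w" "Re w < \<delta>" for w
  proof (rule analytic_continuation_open[where f = "borel_transform b" and g = "\<lambda>w. - L w" and z = w
        and s = "{w. Re w < - 1}"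
        and s' = "{w. 1 < cmod w \<and> Re w < \<delta>}"])
    show "open {w. 1 < cmod w \<and> Re w < \<delta>}"
      by (intro open_Collect_conj open_Collect_less continuous_intros)
    show "connected {w. 1 < cmod w \<and> Re w < \<delta>}"
      using \<delta> by (intro connected_halfplane_minus_disc) auto
    show "{w. Re w < - 1} \<subseteq> {w. 1 < cmod w \<and> Re w < \<delta>}"
    proof safe
      fix w assume "Re w < - 1"
      then show "1 < cmod w" "Re w < \<delta>" using abs_Re_le_cmod[of w] \<delta> by linarith+
    qed
    show "{w. Re w < - 1} \<noteq> {}" by (auto intro: exI[of _ "-2"])
    show "borel_transform b holomorphic_on {w. 1 < cmod w \<and> Re w < \<delta>}"
      by (rule holomorphic_on_subset[OF borel_transform_holomorphic[OF b]]) auto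
    show "(\<lambda>w. - L w) holomorphic_on {w. 1 < cmod w \<and> Re w < \<delta>}"
      by (intro holomorphic_intros holomorphic_on_subset[OF L(1)]) auto
  qed (use w L(2) open_halfspace_Re_lt in auto)
  show ?thesis
  proof (rule that)
    show "(\<lambda>w. if w \<in> {w. 1 < cmod w} then borel_transform b w else - L w)
        holomorphic_on {w. 1 < cmod w} \<union> {w. Re w < \<delta>}"
      using eq by (intro holomorphic_on_If_Un borel_transform_holomorphic[OF b] holomorphic_intros L
          open_halfspace_Re_lt open_Collect_less continuous_intros) auto
  qed simp
qed

section \<open>The sequence as moments over a circle in the right half-plane\<close>

text \<open>Integrate term by term: only the term with \<open>k = n\<close> contributes. The
  condition on \<open>r\<close> puts the closed unit disc strictly inside the circle, so the series
  converges uniformly on it.\<close>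

lemma contour_integral_borel_transform_power:
  assumes b: "\<And>n. cmod (b n) \<le> B" and r: "1 + cmod c < r"
  shows "contour_integral (circlepath c r) (\<lambda>w. borel_transform b w * w ^ n) = 2 * pi * \<i> * b n"
proof -
  have r0: "0 < r" using r norm_ge_zero[of c] by linarith
  define \<rho> where "\<rho> = r - cmod c"
  have \<rho>: "1 < \<rho>" using r by (simp add: \<rho>_def)
  have far: "\<rho> \<le> cmod w" if "w \<in> sphere c r" for w
    using that norm_triangle_ineq4[of w c] by (simp add: \<rho>_def dist_norm norm_minus_commute)
  have integral_term: "((\<lambda>w. b k * (w ^ n / w ^ Suc k)) has_contour_integral (if k = n then 2 * pi * \<i> * b n else 0))
      (circlepath c r)" for k
  proof -
    \<comment> \<open>Cauchy's formula gives the \<open>k\<close>-th derivative of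
      \<open>w ^ n\<close> at 0, which is nonzero only for \<open>k = n\<close>.\<close>
    have "((\<lambda>w. w ^ n / (w - 0) ^ Suc k) has_contour_integral
        2 * pi * \<i> / fact k * (deriv ^^ k) (\<lambda>w. w ^ n) 0) (circlepath c r)"
      using r by (intro Cauchy_has_contour_integral_higher_derivative_circlepath)
        (auto intro!: continuous_intros holomorphic_intros simp: dist_norm)
    moreover have "(deriv ^^ k) (\<lambda>w. w ^ n) (0 :: complex) = (if k = n then fact n else 0)"
      using higher_deriv_power[of k 0 n 0]
      by (auto simp: pochhammer_fact[symmetric] Suc_diff_le power_0_left pochhammer_0_left not_less)
    ultimately have "((\<lambda>w. w ^ n / w ^ Suc k) has_contour_integral (if k = n then 2 * pi * \<i> else 0)) (circlepath c r)"
      by (auto split: if_splits)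
    from has_contour_integral_lmul[OF this, of "b k"] show ?thesis
      by (auto simp: mult.commute split: if_splits)
  qed
  have sums: "((\<lambda>w. \<Sum>k<N. b k * (w ^ n / w ^ Suc k)) has_contour_integral
      (\<Sum>k<N. if k = n then 2 * pi * \<i> * b n else 0)) (circlepath c r)" for N
    by (intro has_contour_integral_sum integral_term) simp
  have "uniform_limit (sphere c r) (\<lambda>N w. \<Sum>k<N. b k * (w ^ n / w ^ Suc k))
      (\<lambda>w. \<Sum>k. b k * (w ^ n / w ^ Suc k)) sequentially"
  proof (rule Weierstrass_m_test)
    show "summable (\<lambda>k. (cmod c + r) ^ n * (B * (1 / \<rho>) ^ Suc k))"
      by (intro summable_mult sums_summable[OF geometric_tail_sums[OF \<rho>]])
    fix k w assume w: "w \<in> sphere c r"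
    have B: "0 \<le> B" using order_trans[OF norm_ge_zero b] .
    have "cmod w \<le> cmod c + r"
      using w norm_triangle_sub[of w c] by (simp add: dist_norm norm_minus_commute)
    moreover have "cmod (b k / w ^ Suc k) \<le> B * (1 / \<rho>) ^ Suc k"
    proof -
      have "cmod (b k / w ^ Suc k) \<le> B * (1 / cmod w) ^ Suc k"
        by (rule borel_transform_term_le) (rule b)
      also have "\<dots> \<le> B * (1 / \<rho>) ^ Suc k"
        using far[OF w] \<rho> B by (intro mult_left_mono power_mono divide_left_mono mult_pos_pos) auto
      finally show ?thesis .
    qed
    ultimately have "cmod (w ^ n) * cmod (b k / w ^ Suc k) \<le> (cmod c + r) ^ n * (B * (1 / \<rho>) ^ Suc k)"
      using r0 B \<rho> by (intro mult_mono) (auto simp: norm_power intro!: power_mono)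
    then show "cmod (b k * (w ^ n / w ^ Suc k)) \<le> (cmod c + r) ^ n * (B * (1 / \<rho>) ^ Suc k)"
      by (simp add: norm_mult[symmetric] mult.commute)
  qed
  moreover have "(\<Sum>k. b k * (w ^ n / w ^ Suc k)) = borel_transform b w * w ^ n" if "w \<in> sphere c r" for w
  proof -
    have "1 < cmod w" using far[OF that] \<rho> by linarith
    then have "(\<Sum>k. w ^ n * (b k / w ^ Suc k)) = w ^ n * borel_transform b w"
      unfolding borel_transform_def by (intro suminf_mult summable_borel_transform[of b B, OF b])
    then show ?thesis by (simp add: mult_ac)
  qed
  ultimately have ul: "uniform_limit (sphere c r) (\<lambda>N w. \<Sum>k<N. b k * (w ^ n / w ^ Suc k))
      (\<lambda>w. borel_transform b w * w ^ n) sequentially"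
    by (subst (asm) uniform_limit_cong'[OF refl]) auto
  have "(\<lambda>N. contour_integral (circlepath c r) (\<lambda>w. \<Sum>k<N. b k * (w ^ n / w ^ Suc k)))
      \<longlonglongrightarrow> contour_integral (circlepath c r) (\<lambda>w. borel_transform b w * w ^ n)"
    by (rule contour_integral_uniform_limit_circlepath(2)[OF _ ul])
      (use r0 has_contour_integral_integrable[OF sums] in \<open>auto intro!: always_eventually\<close>)
  then have "(\<lambda>N. \<Sum>k<N. if k = n then 2 * pi * \<i> * b n else 0)
      \<longlonglongrightarrow> contour_integral (circlepath c r) (\<lambda>w. borel_transform b w * w ^ n)"
    by (simp only: contour_integral_unique[OF sums])
  moreover have "(\<lambda>k. if k = n then 2 * pi * \<i> * b n else 0) sums (2 * pi * \<i> * b n)"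
    by (rule sums_single)
  ultimately show ?thesis unfolding sums_def by (rule LIMSEQ_unique)
qed

text \<open>The singularities of the Borel transform lie in the circular segment \<open>cmod w \<le> 1\<close>,
  \<open>\<delta> \<le> Re w\<close>. With centre \<open>1 / \<delta>\<close> a circle of squared radius \<open>1 / \<delta>\<^sup>2 - 1\<close> already encloses it,
  so a slightly larger one still stays in the right half-plane.\<close>

lemma decay_imp_moments:
  assumes b: "\<And>n. cmod (b n) \<le> B"
    and decay: "\<And>t. 0 \<le> t \<Longrightarrow> cmod (egf b (- of_real t)) \<le> C * exp (- \<delta> * t)"
    and \<delta>: "0 < \<delta>" "\<delta> \<le> 1"
  obtains \<phi> W :: "real \<Rightarrow> complex"
  where "continuous_on {0..1} \<phi>" "continuous_on {0..1} W" "\<And>t. t \<in> {0..1} \<Longrightarrow> 0 < Re (W t)"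
    and "\<And>n. b n = integral {0..1} (\<lambda>t. \<phi> t * W t ^ n)"
proof -
  define D where "D = {w. 1 < cmod w} \<union> {w. Re w < \<delta>}"
  have "open D" unfolding D_def
    by (intro open_Un open_halfspace_Re_lt open_Collect_less continuous_intros)
  obtain F where F: "F holomorphic_on D" "\<And>w. 1 < cmod w \<Longrightarrow> F w = borel_transform b w"
    using borel_transform_continuation[OF b decay \<delta>] unfolding D_def by blast
  define \<rho> where "\<rho> = 1 / \<delta>"
  have \<rho>: "1 \<le> \<rho>" "\<rho> * \<delta> = 1" using \<delta> by (auto simp: \<rho>_def)
  then have "1 \<le> \<rho>\<^sup>2" by simp
  \<comment> \<open>Any squared radius strictly between \<open>\<rho>\<^sup>2 - 1\<close> and
    \<open>\<rho>\<^sup>2\<close> would do: the lower end encloses the segment, the upper end keeps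
    the circle off the imaginary axis.\<close>
  define R where "R = sqrt (\<rho>\<^sup>2 - 1/2)"
  have R2: "R\<^sup>2 = \<rho>\<^sup>2 - 1/2" using \<open>1 \<le> \<rho>\<^sup>2\<close> by (simp add: R_def)
  have R: "0 < R" "R < \<rho>"
  proof -
    show "0 < R" using \<open>1 \<le> \<rho>\<^sup>2\<close> by (simp add: R_def)
    show "R < \<rho>" using R2 \<rho> by (intro power_less_imp_less_base[of R 2 \<rho>]) auto
  qed
  have in_D: "w \<in> D" if w: "R \<le> cmod (w - \<rho>)" for w :: complex
  proof (rule ccontr)
    assume "w \<notin> D"
    then have "cmod w \<le> 1" "\<delta> \<le> Re w" by (auto simp: D_def)
    have "(cmod (w - \<rho>))\<^sup>2 = (cmod w)\<^sup>2 - 2 * \<rho> * Re w + \<rho>\<^sup>2"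
      by (simp add: cmod_power2) (simp add: power2_eq_square algebra_simps)
    also have "\<dots> \<le> 1 - 2 * \<rho> * \<delta> + \<rho>\<^sup>2"
      using \<open>cmod w \<le> 1\<close> \<open>\<delta> \<le> Re w\<close> \<rho>(1) by (intro add_mono diff_mono mult_left_mono) (auto simp: power_le_one)
    finally have "(cmod (w - \<rho>))\<^sup>2 < R\<^sup>2" using \<rho>(2) R2 by simp
    moreover have "R\<^sup>2 \<le> (cmod (w - \<rho>))\<^sup>2" using w R by (intro power_mono) auto
    ultimately show False by linarith
  qed
  \<comment> \<open>Large enough for \<open>1 + cmod \<rho> < r\<close>, as the moment formula
    demands.\<close>
  define r where "r = \<rho> + 2"
  \<comment> \<open>The radial homotopy between the concentric circles never comes closer to
    \<open>\<rho>\<close> than \<open>R\<close>, hence stays in \<open>D\<close>.\<close>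
  have homotopic: "homotopic_loops D (circlepath \<rho> R) (circlepath \<rho> r)"
  proof (rule homotopic_loops_linear)
    fix t :: real
    show "closed_segment (circlepath \<rho> R t) (circlepath \<rho> r t) \<subseteq> D"
    proof
      fix w assume "w \<in> closed_segment (circlepath \<rho> R t) (circlepath \<rho> r t)"
      then obtain u where u: "0 \<le> u" "u \<le> 1"
        "w = (1 - u) *\<^sub>R circlepath \<rho> R t + u *\<^sub>R circlepath \<rho> r t"
        by (auto simp: in_segment)
      have "w - \<rho> = of_real ((1 - u) * R + u * r) * exp (2 * of_real pi * \<i> * of_real t)"
        by (simp add: u(3) circlepath scaleR_conv_of_real algebra_simps)
      then have "cmod (w - \<rho>) = \<bar>(1 - u) * R + u * r\<bar>" by (simp add: norm_mult del: of_real_add of_real_mult)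
      moreover have "R \<le> (1 - u) * R + u * r"
        using u R mult_left_mono[of R r u] by (simp add: r_def algebra_simps)
      ultimately show "w \<in> D" using R by (intro in_D) auto
    qed
  qed auto
  define W where "W = circlepath \<rho> R"
  \<comment> \<open>The density is \<open>F\<close> times the velocity of the circle without its
    factor \<open>2 * pi * \<i>\<close>, which cancels against the one in the moment
    formula.\<close>
  define \<phi> where "\<phi> t = F (W t) * (R * exp (2 * of_real pi * \<i> * of_real t))" for t :: real
  have W_dist: "cmod (W t - \<rho>) = R" for t
    using R by (simp add: W_def circlepath norm_mult)
  show ?thesis
  proof (rule that[of \<phi> W])
    show cW: "continuous_on {0..1} W" unfolding W_def circlepath by (intro continuous_intros)
    have "continuous_on {0..1} (\<lambda>t. F (W t))"
      using in_D W_dist holomorphic_on_imp_continuous_on[OF F(1)]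
      by (intro continuous_on_compose2[OF _ cW]) auto
    then show "continuous_on {0..1} \<phi>" unfolding \<phi>_def by (intro continuous_intros)
    show "0 < Re (W t)" for t
      using abs_Re_le_cmod[of "W t - \<rho>"] W_dist[of t] R by simp
    fix n
    have "2 * pi * \<i> * b n = contour_integral (circlepath \<rho> r) (\<lambda>w. borel_transform b w * w ^ n)"
      using \<rho> by (intro contour_integral_borel_transform_power[of b B, OF b, symmetric]) (auto simp: r_def)
    also have "\<dots> = contour_integral (circlepath \<rho> r) (\<lambda>w. F w * w ^ n)"
    proof (rule contour_integral_cong)
      fix w assume "w \<in> path_image (circlepath \<rho> r)"
      then have "r \<le> \<rho> + cmod w"
        using norm_triangle_ineq4[of w \<rho>] \<rho> by (simp add: r_def dist_norm norm_minus_commute)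
      then have "1 < cmod w" by (simp add: r_def)
      then show "borel_transform b w * w ^ n = F w * w ^ n" by (simp add: F(2))
    qed simp
    also have "\<dots> = contour_integral (circlepath \<rho> R) (\<lambda>w. F w * w ^ n)"
      by (rule Cauchy_theorem_homotopic_loops[OF homotopic \<open>open D\<close>, symmetric])
        (auto intro!: holomorphic_intros F)
    also have "\<dots> = integral {0..1} (\<lambda>t. 2 * pi * \<i> * (\<phi> t * W t ^ n))"
      unfolding contour_integral_integral vector_derivative_circlepath
      by (simp add: \<phi>_def W_def mult_ac)
    also have "\<dots> = 2 * pi * \<i> * integral {0..1} (\<lambda>t. \<phi> t * W t ^ n)"
      by (rule integral_mult_right)
    finally show "b n = integral {0..1} (\<lambda>t. \<phi> t * W t ^ n)" by simp
  qed
qed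

section \<open>Zero-free entire functions of exponential type\<close>

text \<open>The Borel-Caratheodory inequality for radii \<open>r\<close> and \<open>2 * r\<close>.
  The map \<open>v / (2 * M - v)\<close> takes the half-plane \<open>Re v < M\<close> into the unit
  disc and fixes 0, so the Schwarz lemma applies; solving its bound for \<open>g z\<close> gives the
  claim.\<close>

lemma Re_bound_imp_norm_bound:
  fixes g :: "complex \<Rightarrow> complex"
  assumes hol: "g holomorphic_on ball 0 (2 * r)" and r: "0 < r" and g0: "g 0 = 0"
    and Re_le: "\<And>z. cmod z < 2 * r \<Longrightarrow> Re (g z) < M" and z: "cmod z \<le> r"
  shows "cmod (g z) \<le> 2 * M"
proof -
  have M: "M > 0" using Re_le[of 0] r g0 by simp
  define \<phi> where "\<phi> = (\<lambda>\<zeta> :: complex. g (2 * r * \<zeta>) / (2 * M - g (2 * r * \<zeta>)))"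
  have in_ball: "cmod (2 * r * \<zeta>) < 2 * r" if "cmod \<zeta> < 1" for \<zeta> :: complex
    using that r by (simp add: norm_mult)
  have ne: "2 * M - g (2 * r * \<zeta>) \<noteq> 0" if "cmod \<zeta> < 1" for \<zeta> :: complex
  proof
    assume "2 * M - g (2 * r * \<zeta>) = 0"
    then have "Re (g (2 * r * \<zeta>)) = 2 * M" by (metis Re_complex_of_real eq_iff_diff_eq_0 of_real_mult of_real_numeral)
    then show False using Re_le[OF in_ball[OF that]] M by simp
  qed
  have hol': "\<phi> holomorphic_on ball 0 1"
  proof -
    have "(\<lambda>\<zeta> :: complex. 2 * r * \<zeta>) ` ball 0 1 \<subseteq> ball 0 (2 * r)"
      using in_ball by auto
    then have "(g \<circ> (\<lambda>\<zeta> :: complex. 2 * r * \<zeta>)) holomorphic_on ball 0 1"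
      by (intro holomorphic_on_compose_gen[OF _ hol] holomorphic_intros)
    then have "(\<lambda>\<zeta> :: complex. g (2 * r * \<zeta>)) holomorphic_on ball 0 1" by (simp add: o_def)
    then show ?thesis
      unfolding \<phi>_def using ne by (intro holomorphic_on_divide holomorphic_intros) auto
  qed
  have lt1: "cmod (\<phi> \<zeta>) < 1" if "cmod \<zeta> < 1" for \<zeta>
  proof -
    define v where "v = g (2 * r * \<zeta>)"
    have "Re v < M" unfolding v_def using Re_le[OF in_ball[OF that]] .
    \<comment> \<open>Four times this product is the difference of the two squared moduli compared
      next.\<close>
    then have "0 < M * (M - Re v)" using M by simp
    then have "cmod v ^ 2 < cmod (2 * M - v) ^ 2"
      by (simp add: cmod_power2) (simp add: power2_eq_square algebra_simps)
    then have "cmod v < cmod (2 * M - v)" by (rule power_less_imp_less_base) simp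
    then show ?thesis using ne[OF that] by (simp add: \<phi>_def norm_divide v_def)
  qed
  define \<zeta> where "\<zeta> = z / (2 * r)"
  have \<zeta>: "cmod \<zeta> \<le> 1/2" using z r by (simp add: \<zeta>_def norm_divide field_simps)
  have z_eq: "2 * r * \<zeta> = z" using r by (simp add: \<zeta>_def)
  have "\<phi> \<zeta> = g z / (2 * M - g z)" by (simp only: \<phi>_def z_eq)
  moreover have "cmod (\<phi> \<zeta>) \<le> 1/2"
    using Schwarz_Lemma(1)[OF hol' _ lt1, of \<zeta>] \<zeta> g0 by (simp add: \<phi>_def)
  moreover have "2 * M - g z \<noteq> 0" using ne[of \<zeta>] \<zeta> z_eq by auto
  ultimately have "cmod (g z) / cmod (2 * M - g z) \<le> 1/2" "0 < cmod (2 * M - g z)"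
    by (simp_all add: norm_divide)
  then have "cmod (g z) \<le> 1/2 * cmod (2 * M - g z)"
    by (simp only: pos_divide_le_eq)
  also have "\<dots> \<le> 1/2 * (2 * M + cmod (g z))"
    using norm_triangle_ineq4[of "complex_of_real (2 * M)" "g z"] M by simp
  finally show ?thesis by simp
qed

text \<open>A special case of Hadamard factorization. An entire logarithm exists, the growth bound
  controls its real part linearly, the previous lemma upgrades this to its modulus, and Liouville
  leaves degree at most 1.\<close>

lemma zero_free_exponential_type:
  fixes \<Phi> :: "complex \<Rightarrow> complex"
  assumes hol: "\<Phi> holomorphic_on UNIV" and nz: "\<And>z. \<Phi> z \<noteq> 0"
    and bd: "\<And>z. cmod (\<Phi> z) \<le> exp (A * cmod z + B)" and AB: "0 \<le> A" "0 \<le> B"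
  obtains c \<beta> where "\<And>z. \<Phi> z = exp (c + \<beta> * z)"
proof -
  obtain g where g: "g holomorphic_on UNIV" "\<And>z. \<Phi> z = exp (g z)"
    using contractible_imp_holomorphic_log[OF hol _ nz] by (auto simp: convex_imp_contractible)
  define h where "h = (\<lambda>z. g z - g 0)"
  \<comment> \<open>The summand 1 makes the bound on \<open>Re (h z)\<close> strict, as
    \<open>Re_bound_imp_norm_bound\<close> requires.\<close>
  define D where "D = B + cmod (g 0) + 1"
  have h: "h holomorphic_on UNIV" unfolding h_def by (intro holomorphic_intros g)
  have Re_h: "Re (h z) < A * cmod z + D" for z
  proof -
    have "exp (Re (g z)) \<le> exp (A * cmod z + B)" using bd[of z] by (simp add: g(2))
    then have "Re (g z) \<le> A * cmod z + B" by simp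
    then show ?thesis using abs_Re_le_cmod[of "g 0"] by (simp add: h_def D_def)
  qed
  have h_bd: "cmod (h z) \<le> (4 * A + 2 * D) * cmod z ^ 1" if z: "1 \<le> cmod z" for z
  proof -
    have "cmod (h z) \<le> 2 * (A * (2 * cmod z) + D)"
    proof (rule Re_bound_imp_norm_bound[where g = h and z = z and r = "cmod z"])
      show "Re (h w) < A * (2 * cmod z) + D" if "cmod w < 2 * cmod z" for w
        using Re_h[of w] mult_left_mono[of "cmod w" "2 * cmod z" A] that AB by simp
    qed (use z h in \<open>auto simp: h_def intro: holomorphic_on_subset\<close>)
    also have "\<dots> \<le> 2 * (A * (2 * cmod z) + D * cmod z)"
      using mult_left_mono[OF z, of D] AB by (simp add: D_def)
    finally show ?thesis by (simp add: algebra_simps)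
  qed
  have h_lin: "h z = deriv h 0 * z" for z
  proof -
    have "h 0 = 0" by (simp add: h_def)
    have "h z = (\<Sum>k\<le>1. (deriv ^^ k) h 0 / fact k * z ^ k)"
      by (rule Liouville_polynomial[OF h h_bd])
    also have "\<dots> = deriv h 0 * z" using \<open>h 0 = 0\<close> by simp
    finally show ?thesis .
  qed
  have "\<Phi> z = exp (g 0 + deriv h 0 * z)" for z
  proof -
    have "g z = g 0 + h z" by (simp add: h_def)
    then show ?thesis by (simp only: g(2) h_lin)
  qed
  then show ?thesis by (rule that)
qed

section \<open>Complex powers in place of integer powers\<close>

lemma continuous_on_powr_slit:
  fixes f :: "'a::topological_space \<Rightarrow> complex"
  assumes "continuous_on A f" "\<And>x. x \<in> A \<Longrightarrow> f x \<notin> \<real>\<^sub>\<le>\<^sub>0"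
  shows "continuous_on A (\<lambda>x. f x powr s)"
proof (rule continuous_on_powr_complex)
  show "A \<subseteq> {x. 0 \<le> Re (f x) \<or> Im (f x) \<noteq> 0}"
    using assms(2) by (force simp: complex_nonpos_Reals_iff)
  show "0 < Re s" if "x \<in> A" "f x = 0" for x
    using assms(2)[OF that(1)] that(2) by simp
qed (use assms in \<open>auto intro: continuous_on_const\<close>)

text \<open>For \<open>z \<ge> 0\<close> the point \<open>z + u\<close> stays off the slit, so \<open>\<integral> \<psi> (z + u) powr s\<close> continues
  analytically from large \<open>z\<close>, where the binomial series expresses it through the moments, down
  to \<open>z = 0\<close>.\<close>

lemma moments_determine_powr:
  fixes \<psi> u :: "'a::euclidean_space \<Rightarrow> complex" and p q :: 'a and s :: complex
  defines "I \<equiv> cbox p q"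
  assumes cont_\<psi>: "continuous_on I \<psi>" and cont_u: "continuous_on I u"
    and slit: "\<And>x. x \<in> I \<Longrightarrow> u x \<notin> \<real>\<^sub>\<le>\<^sub>0"
    and moments: "\<And>n. integral I (\<lambda>x. \<psi> x * u x ^ n) = 1"
  shows "integral I (\<lambda>x. \<psi> x * u x powr s) = 1"
proof -
  have I: "compact I" by (simp add: I_def)
  have cpt: "compact (u ` I)" using cont_u I by (rule compact_continuous_image)
  have "u ` I \<inter> \<real>\<^sub>\<le>\<^sub>0 = {}" using slit by auto
  then obtain \<eta>0 where \<eta>0: "\<eta>0 > 0" "\<And>v w. v \<in> u ` I \<Longrightarrow> w \<in> \<real>\<^sub>\<le>\<^sub>0 \<Longrightarrow> \<eta>0 \<le> dist v w"
    using separate_compact_closed[OF cpt closed_nonpos_Reals_complex] by blast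
  \<comment> \<open>The cap at 1 lets the constant 1 satisfy the same distance estimate as the
    values of \<open>u\<close>.\<close>
  define \<eta> where "\<eta> = min \<eta>0 1"
  have \<eta>: "\<eta> > 0" using \<eta>0(1) by (simp add: \<eta>_def)
  have far_u: "\<eta> \<le> cmod (u x + of_real t)" if "x \<in> I" "0 \<le> t" for x t
    using \<eta>0(2)[of "u x" "- of_real t"] that
    by (simp add: dist_norm complex_nonpos_Reals_iff \<eta>_def)
  have far_1: "\<eta> \<le> cmod (1 + of_real t)" if "0 \<le> t" for t
  proof -
    have "cmod (1 + of_real t) = \<bar>1 + t\<bar>" by (metis norm_of_real of_real_1 of_real_add)
    then show ?thesis using that by (simp add: \<eta>_def)
  qed
  \<comment> \<open>A thin convex neighbourhood of the nonnegative axis. Half-width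
    \<open>\<eta>/2\<close> suffices: if \<open>z + v\<close> were on the slit, \<open>v\<close>
    would lie closer than \<open>\<eta>\<close> to it.\<close>
  define U where "U = {z. - (\<eta>/2) < Re z} \<inter> ({z. - (\<eta>/2) < Im z} \<inter> {z. Im z < \<eta>/2})"
  have "open U"
    unfolding U_def by (intro open_Int open_halfspace_Re_gt open_halfspace_Im_gt open_halfspace_Im_lt)
  have "convex U"
    unfolding U_def by (intro convex_Int convex_halfspace_Re_gt convex_halfspace_Im_gt convex_halfspace_Im_lt)
  have of_real_U: "of_real t \<in> U" if "0 \<le> t" for t
    using that \<eta> by (simp add: U_def)
  have slitU: "z + v \<notin> \<real>\<^sub>\<le>\<^sub>0" if z: "z \<in> U" and v: "\<And>t. 0 \<le> t \<Longrightarrow> \<eta> \<le> cmod (v + of_real t)" for z v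
  proof
    assume "z + v \<in> \<real>\<^sub>\<le>\<^sub>0"
    then obtain r where r: "z + v = of_real r" "r \<le> 0" by (elim nonpos_Reals_cases)
    have v_eq: "v = of_real r - z" using r(1) by (simp add: algebra_simps)
    show False
    proof (cases "Re z \<ge> 0")
      case True
      have "v + of_real (Re z - r) = - \<i> * Im z"
        by (simp add: v_eq complex_eq_iff)
      then have "cmod (v + of_real (Re z - r)) = \<bar>Im z\<bar>" by (simp add: norm_mult)
      then show False using v[of "Re z - r"] True r(2) z \<eta> by (auto simp: U_def)
    next
      case False
      have "cmod (v + of_real (- r)) = cmod z" by (simp add: v_eq)
      also have "\<dots> \<le> \<bar>Re z\<bar> + \<bar>Im z\<bar>" by (rule cmod_le)
      finally show False using v[of "- r"] False r(2) z by (auto simp: U_def)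
    qed
  qed
  have slit_u: "z + u x \<notin> \<real>\<^sub>\<le>\<^sub>0" if "z \<in> U" "x \<in> I" for z x
    using slitU[OF that(1)] far_u[OF that(2)] by blast
  have slit_1: "z + 1 \<notin> \<real>\<^sub>\<le>\<^sub>0" if "z \<in> U" for z
    using slitU[OF that] far_1 by blast
  \<comment> \<open>The subtracted term is what a unit mass at \<open>u = 1\<close> would give, the
    model with all moments 1. At \<open>z = 0\<close> it equals 1.\<close>
  define D where "D = (\<lambda>z. integral I (\<lambda>x. \<psi> x * (z + u x) powr s) - (z + 1) powr s)"
  have cont_fst: "continuous_on (U \<times> I) (\<lambda>x. f (snd x))" if "continuous_on I f" for f :: "'a \<Rightarrow> complex"
    by (rule continuous_on_compose2[OF that]) (auto intro!: continuous_intros)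
  have "(\<lambda>z. integral I (\<lambda>x. \<psi> x * (z + u x) powr s)) holomorphic_on U"
    unfolding I_def
  proof (rule leibniz_rule_holomorphic[where fx = "\<lambda>z x. \<psi> x * (s * (z + u x) powr (s - 1))"])
    show "((\<lambda>z. \<psi> x * (z + u x) powr s) has_field_derivative \<psi> x * (s * (z + u x) powr (s - 1)))
        (at z within U)" if "z \<in> U" "x \<in> cbox p q" for z x
      using slit_u[of z x] that by (auto simp: I_def intro!: derivative_eq_intros)
    show "(\<lambda>x. \<psi> x * (z + u x) powr s) integrable_on cbox p q" if "z \<in> U" for z
      using slit_u[OF that] cont_\<psi> cont_u that unfolding I_def
      by (intro integrable_continuous continuous_intros continuous_on_powr_slit) auto
    show "continuous_on (U \<times> cbox p q) (\<lambda>(z, x). \<psi> x * (s * (z + u x) powr (s - 1)))"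
      using slit_u cont_fst[OF cont_\<psi>] cont_fst[OF cont_u]
      unfolding I_def case_prod_unfold
      by (intro continuous_intros continuous_on_powr_slit) auto
  qed fact
  then have hol_D: "D holomorphic_on U"
    unfolding D_def using slit_1 by (intro holomorphic_intros) auto
  obtain K where K: "\<And>x. x \<in> I \<Longrightarrow> cmod (u x) \<le> K" "K \<ge> 1"
  proof -
    obtain K0 where "\<And>x. x \<in> I \<Longrightarrow> cmod (u x) \<le> K0"
      using compact_imp_bounded[OF cpt] by (auto simp: bounded_iff)
    then show ?thesis using that[of "max K0 1"] by (auto simp: le_max_iff_disj)
  qed
  \<comment> \<open>Beyond \<open>2 * K\<close> all quotients \<open>u x / t\<close> have modulus at
    most 1/2, inside the disc of convergence of the binomial series.\<close>
  have D_zero: "D (of_real t) = 0" if t: "t > 2 * K" for t :: real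
  proof -
    have "t > 0" using t K(2) by linarith
    \<comment> \<open>A positive real factor does not change the argument, so no branch of
      \<open>Ln\<close> is crossed.\<close>
    have pow: "(of_real t + v) powr s = of_real t powr s * (1 + v / t) powr s"
      if "of_real t + v \<noteq> 0" for v :: complex
    proof -
      have ne: "1 + v / t \<noteq> 0" using that \<open>t > 0\<close> by (auto simp: field_simps)
      have "of_real t + v = of_real t * (1 + v / t)" using \<open>t > 0\<close> by (simp add: field_simps)
      moreover have "Ln (of_real t * (1 + v / t)) = Ln (of_real t) + Ln (1 + v / t)"
        using ne \<open>t > 0\<close> by (simp add: Ln_times_of_real Ln_of_real)
      ultimately show ?thesis
        using that ne \<open>t > 0\<close> by (simp add: powr_def exp_add distrib_left)
    qed
    have small: "cmod (u x / t) \<le> 1/2" if "x \<in> I" for x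
      using K(1)[OF that] t \<open>t > 0\<close> by (simp add: norm_divide field_simps)
    define M where "M n = cmod (s gchoose n) * (1/2) ^ n" for n
    have "ereal (norm (1/2 :: complex)) < conv_radius (\<lambda>n. s gchoose n)"
      by (simp add: conv_radius_gchoose one_ereal_def)
    then have "summable M"
      unfolding M_def using abs_summable_in_conv_radius[of "1/2 :: complex" "\<lambda>n. s gchoose n"]
      by (simp add: norm_mult norm_power norm_divide)
    obtain P where P: "\<And>x. x \<in> I \<Longrightarrow> cmod (\<psi> x) \<le> P"
      using compact_imp_bounded[OF compact_continuous_image[OF cont_\<psi> I]] by (auto simp: bounded_iff)
    have "uniform_limit I (\<lambda>n x. \<Sum>i<n. \<psi> x * ((s gchoose i) * (u x / t) ^ i))
        (\<lambda>x. \<Sum>i. \<psi> x * ((s gchoose i) * (u x / t) ^ i)) sequentially"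
    proof (rule Weierstrass_m_test)
      show "summable (\<lambda>i. P * M i)" using \<open>summable M\<close> by (rule summable_mult)
      show "cmod (\<psi> x * ((s gchoose i) * (u x / t) ^ i)) \<le> P * M i" if "x \<in> I" for i x
        using P[OF that] small[OF that] order_trans[OF norm_ge_zero P[OF that]]
        unfolding M_def norm_mult norm_power
        by (intro mult_mono power_mono mult_nonneg_nonneg) auto
    qed
    moreover have "(\<Sum>i. \<psi> x * ((s gchoose i) * (u x / t) ^ i)) = \<psi> x * (1 + u x / t) powr s"
      if "x \<in> I" for x
      using sums_mult[OF gen_binomial_complex[of "u x / t" s], of "\<psi> x"] small[OF that]
      by (intro sums_unique[symmetric]) auto
    ultimately have lim: "uniform_limit I (\<lambda>n x. \<Sum>i<n. \<psi> x * ((s gchoose i) * (u x / t) ^ i))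
        (\<lambda>x. \<psi> x * (1 + u x / t) powr s) sequentially"
      by (subst (asm) uniform_limit_cong'[OF refl]) auto
    have int_term: "integral I (\<lambda>x. \<psi> x * ((s gchoose i) * (u x / t) ^ i)) = (s gchoose i) * of_real (1 / t) ^ i" for i
    proof -
      have "integral I (\<lambda>x. \<psi> x * ((s gchoose i) * (u x / t) ^ i))
          = integral I (\<lambda>x. ((s gchoose i) * of_real (1 / t) ^ i) * (\<psi> x * u x ^ i))"
        by (simp add: field_simps)
      also have "\<dots> = ((s gchoose i) * of_real (1 / t) ^ i) * integral I (\<lambda>x. \<psi> x * u x ^ i)"
        by (rule integral_mult_right)
      finally show ?thesis by (simp add: moments)
    qed
    obtain J L where J: "\<And>n. ((\<lambda>x. \<Sum>i<n. \<psi> x * ((s gchoose i) * (u x / t) ^ i)) has_integral J n) I"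
      and L: "((\<lambda>x. \<psi> x * (1 + u x / t) powr s) has_integral L) I" "J \<longlonglongrightarrow> L"
    proof (rule uniform_limit_integral_cbox[OF lim[unfolded I_def]])
      show "continuous_on (cbox p q) (\<lambda>x. \<Sum>i<n. \<psi> x * ((s gchoose i) * (u x / t) ^ i))" for n
        using cont_\<psi> cont_u \<open>t > 0\<close> unfolding I_def by (intro continuous_intros) auto
    qed (auto simp: I_def)
    have J_eq: "J n = (\<Sum>i<n. (s gchoose i) * of_real (1 / t) ^ i)" for n
    proof -
      have "((\<lambda>x. \<Sum>i<n. \<psi> x * ((s gchoose i) * (u x / t) ^ i)) has_integral
          (\<Sum>i<n. integral I (\<lambda>x. \<psi> x * ((s gchoose i) * (u x / t) ^ i)))) I"
        using cont_\<psi> cont_u \<open>t > 0\<close> unfolding I_def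
        by (intro has_integral_sum integrable_integral integrable_continuous continuous_intros) auto
      with J[of n] have "J n = (\<Sum>i<n. integral I (\<lambda>x. \<psi> x * ((s gchoose i) * (u x / t) ^ i)))"
        by (rule has_integral_unique)
      then show ?thesis by (simp add: int_term)
    qed
    \<comment> \<open>With all moments 1, the integrated series is the binomial series of
      \<open>1 + 1 / t\<close>.\<close>
    have "(\<lambda>i. (s gchoose i) * of_real (1 / t) ^ i) sums integral I (\<lambda>x. \<psi> x * (1 + u x / t) powr s)"
      unfolding sums_def J_eq[symmetric] using L by (simp add: integral_unique)
    moreover have "(\<lambda>i. (s gchoose i) * of_real (1 / t) ^ i) sums (1 + of_real (1 / t)) powr s"
      using t K(2) by (intro gen_binomial_complex) (simp add: norm_divide)
    ultimately have "integral I (\<lambda>x. \<psi> x * (1 + u x / t) powr s) = (1 + of_real (1 / t)) powr s"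
      by (rule sums_unique2)
    moreover have "integral I (\<lambda>x. \<psi> x * (of_real t + u x) powr s)
        = integral I (\<lambda>x. of_real t powr s * (\<psi> x * (1 + u x / t) powr s))"
    proof (rule integral_cong)
      fix x assume "x \<in> I"
      then have "of_real t + u x \<noteq> 0" using slit_u[OF of_real_U, of t x] \<open>t > 0\<close> by auto
      then show "\<psi> x * (of_real t + u x) powr s = of_real t powr s * (\<psi> x * (1 + u x / t) powr s)"
        by (subst pow) (simp_all add: mult.left_commute)
    qed
    moreover have "(of_real t + 1) powr s = of_real t powr s * (1 + of_real (1 / t)) powr s"
    proof -
      have "of_real t + 1 \<noteq> (0 :: complex)" using slit_1[OF of_real_U, of t] \<open>t > 0\<close> by auto
      then show ?thesis by (subst pow) simp_all
    qed
    ultimately show ?thesis by (simp only: D_def integral_mult_right diff_self)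
  qed
  \<comment> \<open>The identity theorem: \<open>D\<close> vanishes on a ray inside the connected
    set \<open>U\<close>, which contains 0.\<close>
  have "D 0 = 0"
  proof (rule analytic_continuation[OF hol_D \<open>open U\<close>])
    show "connected U" using \<open>convex U\<close> by (rule convex_connected)
    show "of_real ` {2 * K <..} \<subseteq> U" using K(2) by (auto intro!: of_real_U)
    show "of_real (2 * K + 1) \<in> U" using K(2) by (intro of_real_U) simp
    show "of_real (2 * K + 1) islimpt (of_real ` {2 * K <..} :: complex set)"
      unfolding islimpt_approachable
    proof (intro allI impI)
      fix e :: real assume "0 < e"
      then show "\<exists>x'\<in>of_real ` {2 * K <..}. x' \<noteq> complex_of_real (2 * K + 1) \<and> dist x' (of_real (2 * K + 1)) < e"
        by (intro bexI[of _ "of_real (2 * K + 1 + e / 2)"])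
          (auto simp: dist_norm simp flip: of_real_add of_real_diff of_real_mult)
    qed
    show "0 \<in> U" using of_real_U[of 0] by simp
  qed (use D_zero in auto)
  then show ?thesis by (simp add: D_def)
qed

lemma powr_moment_entire:
  fixes \<phi> W :: "'a::euclidean_space \<Rightarrow> complex"
  assumes \<phi>: "continuous_on (cbox p q) \<phi>" and W: "continuous_on (cbox p q) W"
    and slit: "\<And>x. x \<in> cbox p q \<Longrightarrow> W x \<notin> \<real>\<^sub>\<le>\<^sub>0"
  shows "(\<lambda>s. integral (cbox p q) (\<lambda>x. \<phi> x * W x powr s)) holomorphic_on UNIV"
proof (rule leibniz_rule_holomorphic[where fx = "\<lambda>s x. \<phi> x * (W x powr s * Ln (W x))"])
  show "((\<lambda>s. \<phi> x * W x powr s) has_field_derivative \<phi> x * (W x powr s * Ln (W x))) (at s within UNIV)"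
    if "x \<in> cbox p q" for s x
  proof -
    have "W x \<noteq> 0" using slit[OF that] by auto
    then show ?thesis unfolding powr_def by (auto intro!: derivative_eq_intros)
  qed
  show "(\<lambda>x. \<phi> x * W x powr s) integrable_on cbox p q" for s
    using \<phi> W slit by (intro integrable_continuous continuous_intros continuous_on_powr_slit)
  have snd: "continuous_on (UNIV \<times> cbox p q) (\<lambda>y. f (snd y))" if "continuous_on (cbox p q) f"
    for f :: "'a \<Rightarrow> complex"
    by (rule continuous_on_compose2[OF that]) (auto intro!: continuous_intros)
  have "continuous_on (UNIV \<times> cbox p q) (\<lambda>(s, x). \<phi> x * (exp (s * Ln (W x)) * Ln (W x)))"
    using snd[OF \<phi>] snd[OF W] slit unfolding case_prod_unfold by (intro continuous_intros) auto
  then show "continuous_on (UNIV \<times> cbox p q) (\<lambda>(s, x). \<phi> x * (W x powr s * Ln (W x)))"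
    by (rule continuous_on_eq) (use slit in \<open>force simp: powr_def\<close>)
qed simp

section \<open>Unimodular moments form a geometric sequence\<close>

text \<open>\<open>b n * cnj (b n) = 1\<close> becomes a moment over the unit square, with density
  \<open>\<psi>\<close> and product variable \<open>u\<close>. The passage to complex powers factors
  as \<open>\<Phi> s * \<Phi>' s\<close>, with \<open>\<Phi>'\<close> built from the conjugate
  data.\<close>

lemma unimodular_moments:
  fixes \<phi> W :: "real \<Rightarrow> complex"
  assumes \<phi>: "continuous_on {0..1} \<phi>" and W: "continuous_on {0..1} W"
    and Re_W: "\<And>t. t \<in> {0..1} \<Longrightarrow> 0 < Re (W t)"
    and b: "\<And>n. b n = integral {0..1} (\<lambda>t. \<phi> t * W t ^ n)"
    and unimodular: "\<And>n. cmod (b n) = 1"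
  obtains c \<alpha> where "cmod \<alpha> = 1" "\<And>n. b n = c * \<alpha> ^ n"
proof -
  define \<Phi> where "\<Phi> s = integral {0..1} (\<lambda>t. \<phi> t * W t powr s)" for s
  define \<Phi>' where "\<Phi>' s = integral {0..1} (\<lambda>t. cnj (\<phi> t) * cnj (W t) powr s)" for s
  have slit: "W t \<notin> \<real>\<^sub>\<le>\<^sub>0" if "t \<in> {0..1}" for t
    using Re_W[OF that] by (auto simp: complex_nonpos_Reals_iff)
  have prod_integral: "integral (cbox (0, 0) (1, 1)) (\<lambda>x. f (fst x) * g (snd x)) = integral {0..1} f * integral {0..1} g"
    if f: "continuous_on {0..1} f" and g: "continuous_on {0..1} g" for f g :: "real \<Rightarrow> complex"
  proof -
    have "continuous_on (cbox (0, 0) (1, 1)) (\<lambda>x. f (fst x) * g (snd x))"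
      by (intro continuous_intros continuous_on_compose2[OF f] continuous_on_compose2[OF g])
        (auto simp: cbox_Pair_eq)
    then show ?thesis
      by (subst integral_prod_continuous) (simp_all add: cbox_interval)
  qed
  define I where "I = cbox (0 :: real, 0 :: real) (1, 1)"
  define \<psi> where "\<psi> x = \<phi> (fst x) * cnj (\<phi> (snd x))" for x
  define u where "u x = W (fst x) * cnj (W (snd x))" for x
  have inI: "fst x \<in> {0..1}" "snd x \<in> {0..1}" if "x \<in> I" for x
    using that by (auto simp: I_def cbox_Pair_eq)
  have contI: "continuous_on I (\<lambda>x. f (fst x))" "continuous_on I (\<lambda>x. f (snd x))"
    if "continuous_on {0..1} f" for f :: "real \<Rightarrow> complex"
    using inI by (auto intro!: continuous_on_compose2[OF that] continuous_intros)
  have slit_u: "u x \<notin> \<real>\<^sub>\<le>\<^sub>0" if "x \<in> I" for x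
  proof
    assume "u x \<in> \<real>\<^sub>\<le>\<^sub>0"
    then obtain r where r: "W (fst x) * cnj (W (snd x)) = of_real r" "r \<le> 0"
      unfolding u_def by (elim nonpos_Reals_cases)
    \<comment> \<open>Multiplying by \<open>W (snd x)\<close> isolates \<open>W (fst x)\<close>; the
      real parts of the two sides then have opposite signs.\<close>
    have "W (fst x) * of_real ((cmod (W (snd x)))\<^sup>2) = of_real r * W (snd x)"
      unfolding complex_norm_square r(1)[symmetric] by (simp only: mult_ac)
    from arg_cong[OF this, of Re] have "Re (W (fst x)) * (cmod (W (snd x)))\<^sup>2 = r * Re (W (snd x))"
      by (simp only: Re_complex_of_real times_complex.sel Im_complex_of_real)
    moreover have "0 < Re (W (fst x)) * (cmod (W (snd x)))\<^sup>2"
    proof (rule mult_pos_pos)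
      show "0 < Re (W (fst x))" using Re_W[OF inI(1)[OF that]] .
      show "0 < (cmod (W (snd x)))\<^sup>2" using Re_W[OF inI(2)[OF that]] by auto
    qed
    moreover have "r * Re (W (snd x)) \<le> 0"
      using Re_W[OF inI(2)[OF that]] r(2) by (intro mult_nonpos_nonneg) auto
    ultimately show False by linarith
  qed
  have u_powr: "u x powr s = W (fst x) powr s * cnj (W (snd x)) powr s" if "x \<in> I" for x s
  proof -
    have pos: "0 < Re (W (fst x))" "0 < Re (cnj (W (snd x)))" using Re_W inI[OF that] by auto
    then have ne: "W (fst x) \<noteq> 0" "W (snd x) \<noteq> 0" by auto
    \<comment> \<open>Both arguments lie strictly between -pi/2 and pi/2, so their sum stays in the
      principal range.\<close>
    have "Ln (u x) = Ln (W (fst x)) + Ln (cnj (W (snd x)))"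
      unfolding u_def using pos[THEN Re_Ln_pos_lt_imp] ne by (intro Ln_times_simple) auto
    then show ?thesis using ne by (simp add: powr_def u_def exp_add distrib_left)
  qed
  have moments: "integral I (\<lambda>x. \<psi> x * u x ^ n) = 1" for n
  proof -
    have "integral I (\<lambda>x. \<psi> x * u x ^ n) = integral I (\<lambda>x. (\<phi> (fst x) * W (fst x) ^ n) * cnj (\<phi> (snd x) * W (snd x) ^ n))"
      by (simp add: \<psi>_def u_def power_mult_distrib mult_ac)
    also have "\<dots> = b n * cnj (b n)"
      unfolding I_def b integral_cnj using \<phi> W by (intro prod_integral continuous_intros)
    also have "\<dots> = 1" by (simp add: complex_norm_square[symmetric] unimodular)
    finally show ?thesis .
  qed
  have "continuous_on I \<psi>" "continuous_on I u"
    unfolding \<psi>_def u_def using contI[OF \<phi>] contI[OF W] by (auto intro!: continuous_intros)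
  then have "integral I (\<lambda>x. \<psi> x * u x powr s) = 1" for s
    using moments slit_u unfolding I_def by (intro moments_determine_powr)
  moreover have "integral I (\<lambda>x. \<psi> x * u x powr s) = \<Phi> s * \<Phi>' s" for s
  proof -
    have "integral I (\<lambda>x. \<psi> x * u x powr s) =
        integral I (\<lambda>x. (\<phi> (fst x) * W (fst x) powr s) * (cnj (\<phi> (snd x)) * cnj (W (snd x)) powr s))"
      by (rule integral_cong) (simp add: \<psi>_def u_powr mult_ac)
    also have "\<dots> = \<Phi> s * \<Phi>' s"
      unfolding I_def \<Phi>_def \<Phi>'_def using \<phi> W slit
      by (intro prod_integral continuous_intros continuous_on_powr_slit) (auto simp: complex_nonpos_Reals_iff)
    finally show ?thesis .
  qed
  ultimately have nz: "\<Phi> s \<noteq> 0" for s by (metis mult_zero_left zero_neq_one)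
  have hol: "\<Phi> holomorphic_on UNIV"
    using powr_moment_entire[of 0 1 \<phi> W] \<phi> W slit by (simp add: \<Phi>_def[abs_def])
  \<comment> \<open>Taking \<open>1 \<le> P\<close> makes \<open>ln P\<close> nonnegative, as
    required of the additive constant in the growth bound.\<close>
  obtain P where P: "\<And>t. t \<in> {0..1} \<Longrightarrow> cmod (\<phi> t) \<le> P" "1 \<le> P"
  proof -
    obtain P where "\<And>t. t \<in> {0..1} \<Longrightarrow> cmod (\<phi> t) \<le> P"
      using compact_imp_bounded[OF compact_continuous_image[OF \<phi> compact_Icc]]
      unfolding bounded_iff by blast
    then show ?thesis using that[of "max P 1"] by (auto simp: le_max_iff_disj)
  qed
  obtain A where A: "\<And>t. t \<in> {0..1} \<Longrightarrow> cmod (Ln (W t)) \<le> A" "0 \<le> A"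
  proof -
    have "continuous_on {0..1} (\<lambda>t. Ln (W t))" using slit W by (intro continuous_intros) auto
    from compact_imp_bounded[OF compact_continuous_image[OF this compact_Icc]]
    obtain A where "\<And>t. t \<in> {0..1} \<Longrightarrow> cmod (Ln (W t)) \<le> A"
      unfolding bounded_iff by blast
    then show ?thesis using that[of "max A 0"] by (auto simp: le_max_iff_disj)
  qed
  have bd: "cmod (\<Phi> s) \<le> exp (A * cmod s + ln P)" for s
  proof -
    have "cmod (\<Phi> s) \<le> (P * exp (A * cmod s)) * (1 - 0)"
      unfolding \<Phi>_def
    proof (rule integral_bound)
      show "continuous_on {0..1} (\<lambda>t. \<phi> t * W t powr s)"
        using \<phi> W slit by (intro continuous_intros continuous_on_powr_slit)
      fix t :: real assume t: "t \<in> {0..1}"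
      have "W t \<noteq> 0" using slit[OF t] by auto
      have "cmod (W t powr s) \<le> exp (cmod (s * Ln (W t)))"
        using \<open>W t \<noteq> 0\<close> complex_Re_le_cmod[of "s * Ln (W t)"] by (simp add: powr_def)
      also have "\<dots> \<le> exp (A * cmod s)"
        using mult_right_mono[OF A(1)[OF t], of "cmod s"] by (simp add: norm_mult mult.commute)
      finally show "cmod (\<phi> t * W t powr s) \<le> P * exp (A * cmod s)"
        unfolding norm_mult using P(1)[OF t] P(2) by (intro mult_mono) auto
    qed simp
    then show ?thesis using P(2) by (simp add: exp_add mult.commute)
  qed
  obtain c \<beta> where c: "\<And>z. \<Phi> z = exp (c + \<beta> * z)"
    using zero_free_exponential_type[OF hol nz bd A(2)] P(2) by auto
  have b_eq: "b n = exp c * exp \<beta> ^ n" for n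
  proof -
    have "b n = \<Phi> (of_nat n)"
      unfolding b \<Phi>_def
    proof (rule integral_cong)
      fix t :: real assume "t \<in> {0..1}"
      then have "W t \<noteq> 0" using slit[of t] by auto
      then show "\<phi> t * W t ^ n = \<phi> t * W t powr of_nat n" by (simp add: powr_nat)
    qed
    then show ?thesis by (simp add: c exp_add exp_of_nat2_mult)
  qed
  \<comment> \<open>The modulus of \<open>exp \<beta>\<close> is that of \<open>b 1\<close> divided
    by that of \<open>b 0\<close>.\<close>
  have "cmod (exp \<beta>) = 1"
    using unimodular[of 0] unimodular[of 1] unfolding b_eq by (simp add: norm_mult del: norm_exp_eq_Re)
  then show ?thesis using b_eq by (rule that)
qed

section \<open>From a negative indicator to the theorem\<close>

text \<open>The limsup yields decay only beyond some radius; before it, the growth bound on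
  \<open>f\<close> is absorbed into \<open>C\<close>.\<close>

lemma indicator_neg_imp_decay:
  assumes neg: "indicator_PL f \<theta> < 0" and bd: "\<And>z. cmod (f z) \<le> exp (cmod z)"
  obtains C \<delta> where "0 < \<delta>" "\<delta> \<le> 1"
    "\<And>t. 0 \<le> t \<Longrightarrow> cmod (f (of_real t * cis \<theta>)) \<le> C * exp (- \<delta> * t)"
proof -
  obtain y where "indicator_PL f \<theta> < ereal y" "ereal y < 0"
    using ereal_dense2[OF neg] by auto
  then have "\<forall>\<^sub>F r in at_top. ereal (inverse r) * log_ext (cmod (f (of_real r * cis \<theta>))) < ereal y"
    unfolding indicator_PL_def by (intro Limsup_lessD)
  then obtain T0 where T0: "\<And>r. T0 \<le> r \<Longrightarrow> ereal (inverse r) * log_ext (cmod (f (of_real r * cis \<theta>))) < ereal y"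
    by (auto simp: eventually_at_top_linorder)
  define T where "T = max T0 1"
  \<comment> \<open>Lowering the rate to at most 1 costs nothing and keeps the line
    \<open>Re w = \<delta>\<close> meeting the closed unit disc, as the later geometry
    assumes.\<close>
  define \<delta> where "\<delta> = min (- y) 1"
  have \<delta>: "0 < \<delta>" "\<delta> \<le> 1" "y \<le> - \<delta>" using \<open>ereal y < 0\<close> by (auto simp: \<delta>_def)
  \<comment> \<open>The constant comes from the initial range: for \<open>t \<le> T\<close> and
    \<open>\<delta> \<le> 1\<close> the exponent \<open>t\<close> is at most
    \<open>2 * T - \<delta> * t\<close>.\<close>
  have "cmod (f (of_real t * cis \<theta>)) \<le> exp (2 * T) * exp (- \<delta> * t)" if "0 \<le> t" for t
  proof (cases "t \<le> T")
    case True
    have "cmod (f (of_real t * cis \<theta>)) \<le> exp t"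
      using bd[of "of_real t * cis \<theta>"] that by (simp add: norm_mult)
    also have "t \<le> 2 * T + - \<delta> * t"
      using True that \<delta> mult_right_mono[of \<delta> 1 t] by simp
    finally show ?thesis by (simp add: exp_add[symmetric])
  next
    case False
    then have t: "T0 \<le> t" "1 \<le> t" by (auto simp: T_def)
    have "cmod (f (of_real t * cis \<theta>)) \<le> exp (- \<delta> * t)"
    proof (cases "f (of_real t * cis \<theta>) = 0")
      case nz: False
      then have "ln (cmod (f (of_real t * cis \<theta>))) / t < y"
        using T0[OF t(1)] by (simp add: log_ext_def divide_inverse mult.commute)
      then have "ln (cmod (f (of_real t * cis \<theta>))) < y * t"
        using t by (simp add: field_simps)
      also have "y * t \<le> - \<delta> * t" using \<delta>(3) t by (intro mult_right_mono) auto
      finally show ?thesis using nz by (metis exp_less_cancel_iff exp_ln less_eq_real_def zero_less_norm_iff)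
    qed simp
    also have "\<dots> \<le> exp (2 * T) * exp (- \<delta> * t)" by (simp add: T_def)
    finally show ?thesis .
  qed
  then show ?thesis using \<delta> that by blast
qed

theorem theorem1:
  fixes a :: "nat \<Rightarrow> complex" and f :: "complex \<Rightarrow> complex"
  assumes "\<And>n. cmod (a n) = 1"
    and "\<And>z. f z = (\<Sum>n. a n * z ^ n / fact n)"
  shows "(\<not> (\<exists>c \<alpha>. cmod \<alpha> = 1 \<and> (\<forall>n. a n = c * \<alpha> ^ n))
            \<longrightarrow> (\<forall>\<theta>\<in>{-pi..pi}. indicator_PL f \<theta> \<ge> 0))
       \<and> (\<forall>c \<alpha>. cmod \<alpha> = 1 \<and> (\<forall>n. a n = c * \<alpha> ^ n)
            \<longrightarrow> (\<forall>z. f z = c * exp (\<alpha> * z)))"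
proof (intro conjI impI allI ballI)
  fix \<theta> :: real
  assume not_exp: "\<not> (\<exists>c \<alpha>. cmod \<alpha> = 1 \<and> (\<forall>n. a n = c * \<alpha> ^ n))"
  show "0 \<le> indicator_PL f \<theta>"
  proof (rule ccontr)
    assume "\<not> 0 \<le> indicator_PL f \<theta>"
    then have neg: "indicator_PL f \<theta> < 0" by simp
    have f: "f = egf a" using assms(2) by (simp add: egf_def fun_eq_iff)
    have "cmod (f z) \<le> exp (cmod z)" for z
      using norm_egf_le[of a 1 z] assms(1) by (simp add: f)
    then obtain C \<delta> where \<delta>: "0 < \<delta>" "\<delta> \<le> 1"
      "\<And>t. 0 \<le> t \<Longrightarrow> cmod (f (of_real t * cis \<theta>)) \<le> C * exp (- \<delta> * t)"
      using indicator_neg_imp_decay[OF neg] by metis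
    \<comment> \<open>Twisting the coefficients by powers of \<open>\<omega>\<close> turns the ray
      in direction \<open>\<theta>\<close> into the negative axis and preserves
      unimodularity.\<close>
    define \<omega> where "\<omega> = - cis \<theta>"
    have \<omega>: "cmod \<omega> = 1" by (simp add: \<omega>_def)
    define b where "b n = a n * \<omega> ^ n" for n
    have b: "cmod (b n) = 1" for n by (simp add: b_def norm_mult norm_power \<omega> assms(1))
    have "egf b (- of_real t) = f (of_real t * cis \<theta>)" for t
      by (simp add: f egf_def b_def \<omega>_def mult.assoc power_mult_distrib[symmetric] mult.commute[of "cis \<theta>"])
    then have decay: "cmod (egf b (- of_real t)) \<le> C * exp (- \<delta> * t)" if "0 \<le> t" for t
      using \<delta>(3)[OF that] by simp
    have b_le: "cmod (b n) \<le> 1" for n by (simp add: b)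
    show False
    proof (rule decay_imp_moments[OF b_le decay \<delta>(1,2)])
      fix \<phi> W :: "real \<Rightarrow> complex"
      assume W: "continuous_on {0..1} \<phi>" "continuous_on {0..1} W"
        "\<And>t. t \<in> {0..1} \<Longrightarrow> 0 < Re (W t)" "\<And>n. b n = integral {0..1} (\<lambda>t. \<phi> t * W t ^ n)"
      show False
      proof (rule unimodular_moments[OF W b])
        fix c \<alpha> assume \<alpha>: "cmod \<alpha> = 1" "\<And>n. b n = c * \<alpha> ^ n"
        have "\<omega> \<noteq> 0" using \<omega> by auto
        \<comment> \<open>Undoing the twist produces the geometric form that was excluded.\<close>
        then have "a n = c * (\<alpha> / \<omega>) ^ n" for n
          using \<alpha>(2)[of n] by (simp add: b_def power_divide field_simps)
        moreover have "cmod (\<alpha> / \<omega>) = 1" by (simp add: norm_divide \<alpha>(1) \<omega>)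
        ultimately show False using not_exp by blast
      qed
    qed
  qed
next
  fix c \<alpha> z :: complex
  assume "cmod \<alpha> = 1 \<and> (\<forall>n. a n = c * \<alpha> ^ n)"
  then have "f z = (\<Sum>n. c * ((\<alpha> * z) ^ n /\<^sub>R fact n))"
    by (simp add: assms(2) power_mult_distrib scaleR_conv_of_real divide_inverse mult_ac)
  then show "f z = c * exp (\<alpha> * z)"
    by (simp only: exp_def suminf_mult[OF summable_exp_generic])
qed

end
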